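(* Let $d\geqslant2$. Suppose that the Lévy measure $\Lambda$ on $\mathbb{R}^d$ has Lévy copula $C$ and marginal Lévy measures $\lambda_i$, $i=1,\dots,d$. If (i) $C$ is strictly $d$-increasing, (ii) $\lambda_i\big((-\varepsilon,0)\big)>0$ and $\lambda_i\big((0,\varepsilon)\big)>0$ for any $i=1,\dots,d$ and $\varepsilon>0$, then $\boldsymbol{0}\in\operatorname{int}\operatorname{conv}\operatorname{supp}\Lambda_\varepsilon$ for any $\varepsilon>0$.
   Context: Notation. $\overline{\mathbb{R}}=(-\infty,\infty]$. For $\boldsymbol{a},\boldsymbol{b}\in\overline{\mathbb{R}}^d$, $\boldsymbol{a}\leqslant\boldsymbol{b}$ (resp. $\boldsymbol{a}<\boldsymbol{b}$) means $a_i\leqslant b_i$ (resp. $a_i<b_i$) for all $i$. $\mathrm{sgn}(x)=-\mathbf{1}_{(-\infty,0)}(x)+\mathbf{1}_{[0,\infty)}(x)$ (with $\mathrm{sgn}(\infty)=1$). Rectangular increments. For $F:\overline{\mathbb{R}}^d\to\overline{\mathbb{R}}$ and $\boldsymbol{a}\leqslant\boldsymbol{b}$, $$F\big((\boldsymbol{a},\boldsymbol{b}]\big)=\sum_{\boldsymbol{i}\in\{0,1\}^d}(-1)^{d-\sum_ji_j}F\big((1-i_1)a_1+i_1b_1,\dots,(1-i_d)a_d+i_db_d\big),$$ where $(1-i_j)a_j+i_jb_j$ is understood as $a_j$ if $i_j=0$ and $b_j$ if $i_j=1$. $F$ is $d$-increasing if $F((\boldsymbol{a},\boldsymbol{b}])\geqslant0$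 whenever $\boldsymbol{a}\leqslant\boldsymbol{b}$, and strictly $d$-increasing if $F((\boldsymbol{a},\boldsymbol{b}])>0$ whenever $\boldsymbol{a}<\boldsymbol{b}$. Margins. For $d$-increasing $F$ that vanishes whenever some argument is $0$, and nonempty $I\subset\{1,\dots,d\}$ with complement $I^c$, the $I$-margin is $F^I:\overline{\mathbb{R}}^{|I|}\to\overline{\mathbb{R}}$, $$F^I\big((x_i)_{i\in I}\big)=\lim_{u\to-\infty}\sum_{(x_i)_{i\in I^c}\in\{u,\infty\}^{|I^c|}}F(x_1,\dots,x_d)\prod_{i\in I^c}\mathrm{sgn}(x_i).$$ Lévy copula. A $d$-dimensional Lévy copula is $C:\overline{\mathbb{R}}^d\to\overline{\mathbb{R}}$ such that: $C(x_1,\dots,x_d)<\infty$ when $x_i<\infty$ for all $i$; $C(x_1,\dots,x_d)=0$ when $x_i=0$ for some $i$; $C$ is $d$-increasing; $C^{\{i\}}(x)=x$ for all $x\in\mathbb{R}$ and all $i$. Tail integrals. A Lévy measure on $\mathbb{R}^n$ is a Borel measure with no mass at $\boldsymbol{0}$ that integrates $\min\{1,\|\boldsymbol{x}\|^2\}$. The tail integral of a Lévy measure $\mu$ on $\mathbb{R}^n$ is $J_\mu:(\mathbb{R}\setminus\{0\})^n\to\mathbb{R}$, $J_\mu(x_1,\dots,x_n)=\mu\big(\prod_{j=1}^n\mathscr{I}(x_j)\big)\prod_{i=1}^n\mathrm{sgn}(x_i)$, where $\mathscr{I}(x)=(x,\infty)$ for $x\geqslant0$ and $\mathscr{I}(x)=(-\infty,x]$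 for $x<0$. For nonempty $I$, $J^I_\Lambda$ is the tail integral of the Lévy measure $\Lambda^I$ of the components $(L^i)_{i\in I}$ of a Lévy process $\boldsymbol{L}$ with Lévy measure $\Lambda$, i.e. $\Lambda^I(B)=\Lambda(\{\boldsymbol{x}\in\mathbb{R}^d:(x_i)_{i\in I}\in B\})$ for Borel $B\subset\mathbb{R}^{|I|}\setminus\{\boldsymbol{0}\}$. $\Lambda$ has Lévy copula $C$ and marginal Lévy measures $\lambda_1,\dots,\lambda_d$ (Lévy measures on $\mathbb{R}$) if $J^I_\Lambda\big((x_i)_{i\in I}\big)=C^I\big((J_{\lambda_i}(x_i))_{i\in I}\big)$ for every nonempty $I\subset\{1,\dots,d\}$ and all $(x_i)_{i\in I}\in(\mathbb{R}\setminus\{0\})^{|I|}$. $\Lambda_\varepsilon(A)=\Lambda\big(A\cap B(\boldsymbol{0},\varepsilon)\big)$ for Borel $A\subset\mathbb{R}^d$, where $B(\boldsymbol{0},\varepsilon)$ is the open ball of radius $\varepsilon$ centred at the origin. $\operatorname{supp}$ is the closed support of a measure, $\operatorname{conv}$ the convex hull, $\operatorname{int}$ the interior in $\mathbb{R}^d$. *)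

theory Defs
  imports "HOL-Probability.Probability"
begin

text \<open>
  The extended line \<open>(-\<infinity>, \<infinity>]\<close> is the set \<open>Rbar\<close> of extended reals other than \<open>-\<infinity>\<close>. The index
  set \<open>{1, \<dots>, d}\<close> is a finite type \<open>'d\<close>. Points with extended real coordinates are functions
  \<open>'d \<Rightarrow> ereal\<close>; an object depending on the coordinates in \<open>I\<close> only is given a function on the
  whole index type and ignores its values outside \<open>I\<close>.
\<close>

definition Rbar :: "ereal set"
  where "Rbar = {-\<infinity><..}"

text \<open>Unlike \<^const>\<open>sgn\<close>, this sign function is \<open>1\<close> at \<open>0\<close>.\<close>

definition sign :: "ereal \<Rightarrow> real"
  where "sign x = (if x < 0 then -1 else 1)"


subsection \<open>Rectangular increments, margins and Levy copulas\<close>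

text \<open>
  Sums in \<^typ>\<open>ereal\<close> obey \<open>\<infinity> + (-\<infinity>) = \<infinity>\<close>, so an increment of the undefined form \<open>\<infinity> - \<infinity>\<close> imposes
  no condition in the two monotonicity notions below. For a Levy copula this only concerns
  degenerate boxes at \<open>(\<infinity>, \<dots>, \<infinity>)\<close>, the only point where it can be infinite.
\<close>

definition rect_increment ::
    "(('d::finite \<Rightarrow> ereal) \<Rightarrow> ereal) \<Rightarrow> ('d \<Rightarrow> ereal) \<Rightarrow> ('d \<Rightarrow> ereal) \<Rightarrow> ereal"
  where "rect_increment F a b =
    (\<Sum>i \<in> UNIV \<rightarrow>\<^sub>E {0, 1::nat}.
       (-1) ^ (CARD('d) - (\<Sum>j\<in>UNIV. i j)) * F (\<lambda>j. if i j = 0 then a j else b j))"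

definition d_increasing :: "(('d::finite \<Rightarrow> ereal) \<Rightarrow> ereal) \<Rightarrow> bool"
  where "d_increasing F \<longleftrightarrow>
    (\<forall>a b. (\<forall>i. a i \<in> Rbar \<and> b i \<in> Rbar \<and> a i \<le> b i) \<longrightarrow> 0 \<le> rect_increment F a b)"

definition strictly_d_increasing :: "(('d::finite \<Rightarrow> ereal) \<Rightarrow> ereal) \<Rightarrow> bool"
  where "strictly_d_increasing F \<longleftrightarrow>
    (\<forall>a b. (\<forall>i. a i \<in> Rbar \<and> b i \<in> Rbar \<and> a i < b i) \<longrightarrow> 0 < rect_increment F a b)"

text \<open>
  \<open>has_margin F I x l\<close> says that the limit defining the \<open>I\<close>-margin of \<open>F\<close> at \<open>(x\<^sub>i)\<^sub>i\<^sub>\<in>\<^sub>I\<close> exists and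
  equals \<open>l\<close>.
\<close>

definition has_margin ::
    "(('d::finite \<Rightarrow> ereal) \<Rightarrow> ereal) \<Rightarrow> 'd set \<Rightarrow> ('d \<Rightarrow> ereal) \<Rightarrow> ereal \<Rightarrow> bool"
  where "has_margin F I x l \<longleftrightarrow>
    ((\<lambda>u::real. \<Sum>y \<in> (- I) \<rightarrow>\<^sub>E {ereal u, \<infinity>}.
        F (\<lambda>i. if i \<in> I then x i else y i) * ereal (\<Prod>i\<in>- I. sign (y i)))
      \<longlongrightarrow> l) at_bot"

definition levy_copula :: "(('d::finite \<Rightarrow> ereal) \<Rightarrow> ereal) \<Rightarrow> bool"
  where "levy_copula C \<longleftrightarrow>
    (\<forall>x. (\<forall>i. x i \<in> Rbar) \<longrightarrow> C x \<in> Rbar) \<and>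
    (\<forall>x. (\<forall>i. x i \<in> Rbar \<and> x i < \<infinity>) \<longrightarrow> C x < \<infinity>) \<and>
    (\<forall>x. (\<forall>i. x i \<in> Rbar) \<and> (\<exists>i. x i = 0) \<longrightarrow> C x = 0) \<and>
    d_increasing C \<and>
    (\<forall>i. \<forall>x::real. has_margin C {i} (\<lambda>_. ereal x) (ereal x))"


subsection \<open>Levy measures and tail integrals\<close>

definition levy_measure :: "'a::euclidean_space measure \<Rightarrow> bool"
  where "levy_measure M \<longleftrightarrow>
    sets M = sets borel \<and> emeasure M {0} = 0 \<and> integrable M (\<lambda>x. min 1 ((norm x)\<^sup>2))"

definition half_line :: "real \<Rightarrow> real set"
  where "half_line x = (if 0 \<le> x then {x<..} else {..x})"

text \<open>
  The Levy measure of the components in \<open>I\<close> lives on the product space \<open>\<Pi>\<^sub>M i\<in>I. borel\<close>, which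
  represents \<open>\<real>\<^bsup>|I|\<^esup>\<close>. The image of \<open>\<Lambda>\<close> may charge the origin, so the points with
  \<open>x\<^sub>i = 0\<close> for all \<open>i \<in> I\<close> are removed first.
\<close>

definition marginal_levy_measure ::
    "'d::finite set \<Rightarrow> (real^'d) measure \<Rightarrow> ('d \<Rightarrow> real) measure"
  where "marginal_levy_measure I \<Lambda> =
    distr (density \<Lambda> (indicator {x. \<exists>i\<in>I. x $ i \<noteq> 0})) (\<Pi>\<^sub>M i\<in>I. borel) (\<lambda>x. \<lambda>i\<in>I. x $ i)"

lemma emeasure_marginal_levy_measure:
  fixes \<Lambda> :: "(real^'d) measure"
  assumes \<Lambda>: "sets \<Lambda> = sets borel" and B: "B \<in> sets (\<Pi>\<^sub>M i\<in>I. borel)" and 0: "(\<lambda>i\<in>I. 0) \<notin> B"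
  shows "emeasure (marginal_levy_measure I \<Lambda>) B = emeasure \<Lambda> {x. (\<lambda>i\<in>I. x $ i) \<in> B}"
proof -
  have f: "(\<lambda>x. \<lambda>i\<in>I. x $ i) \<in> \<Lambda> \<rightarrow>\<^sub>M (\<Pi>\<^sub>M i\<in>I. borel)"
    by (subst measurable_cong_sets[OF \<Lambda> refl]) (intro measurable_restrict, measurable)
  have A: "{x. \<exists>i\<in>I. x $ i \<noteq> 0} \<in> sets \<Lambda>"
    unfolding \<Lambda> by measurable
  have sp: "space \<Lambda> = UNIV"
    using sets_eq_imp_space_eq[OF \<Lambda>] by simp
  have P: "{x. (\<lambda>i\<in>I. x $ i) \<in> B} \<in> sets \<Lambda>"
    using measurable_sets[OF f B] by (simp add: sp vimage_def)
  have "{x. (\<lambda>i\<in>I. x $ i) \<in> B} \<subseteq> {x. \<exists>i\<in>I. x $ i \<noteq> 0}"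
  proof safe
    fix x :: "real^'d" assume x: "(\<lambda>i\<in>I. x $ i) \<in> B"
    show "\<exists>i\<in>I. x $ i \<noteq> 0"
    proof (rule ccontr)
      assume "\<not> ?thesis"
      then have "(\<lambda>i\<in>I. x $ i) = (\<lambda>i\<in>I. 0)" by (auto simp: restrict_def)
      with x 0 show False by simp
    qed
  qed
  then have "{x. \<exists>i\<in>I. x $ i \<noteq> 0} \<inter> {x. (\<lambda>i\<in>I. x $ i) \<in> B} = {x. (\<lambda>i\<in>I. x $ i) \<in> B}" by blast
  with f A P B show ?thesis
    by (simp add: marginal_levy_measure_def emeasure_distr emeasure_density sp vimage_def
        indicator_inter_arith[symmetric])
qed

definition tail_integral :: "'d::finite set \<Rightarrow> ('d \<Rightarrow> real) measure \<Rightarrow> ('d \<Rightarrow> real) \<Rightarrow> real"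
  where "tail_integral I M x =
    measure M (\<Pi>\<^sub>E j\<in>I. half_line (x j)) * (\<Prod>i\<in>I. sign (ereal (x i)))"

text \<open>The one-dimensional case, for measures on \<^typ>\<open>real\<close> itself.\<close>

definition tail_integral_real :: "real measure \<Rightarrow> real \<Rightarrow> real"
  where "tail_integral_real M x = measure M (half_line x) * sign (ereal x)"

definition has_levy_copula ::
    "(real^'d) measure \<Rightarrow> (('d::finite \<Rightarrow> ereal) \<Rightarrow> ereal) \<Rightarrow> ('d \<Rightarrow> real measure) \<Rightarrow> bool"
  where "has_levy_copula \<Lambda> C \<mu> \<longleftrightarrow>
    (\<forall>I x. I \<noteq> {} \<and> (\<forall>i\<in>I. x i \<noteq> 0) \<longrightarrow>
      has_margin C I (\<lambda>i. ereal (tail_integral_real (\<mu> i) (x i)))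
        (ereal (tail_integral I (marginal_levy_measure I \<Lambda>) x)))"


subsection \<open>Small jumps and supports\<close>

definition small_jumps :: "(real^'d) measure \<Rightarrow> real \<Rightarrow> (real^'d) measure"
  where "small_jumps \<Lambda> \<epsilon> = density \<Lambda> (indicator (ball 0 \<epsilon>))"

lemma emeasure_small_jumps:
  assumes "sets \<Lambda> = sets borel" "A \<in> sets borel"
  shows "emeasure (small_jumps \<Lambda> \<epsilon>) A = emeasure \<Lambda> (A \<inter> ball 0 \<epsilon>)"
proof -
  have "ball 0 \<epsilon> \<in> sets \<Lambda>" "A \<in> sets \<Lambda>" using assms by simp_all
  then have "emeasure (small_jumps \<Lambda> \<epsilon>) A
      = (\<integral>\<^sup>+ x. indicator (A \<inter> ball 0 \<epsilon>) x \<partial>\<Lambda>)"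
    unfolding small_jumps_def
    by (subst emeasure_density, simp, simp, intro nn_integral_cong)
      (simp split: split_indicator)
  also have "\<dots> = emeasure \<Lambda> (A \<inter> ball 0 \<epsilon>)"
    using \<open>ball 0 \<epsilon> \<in> sets \<Lambda>\<close> \<open>A \<in> sets \<Lambda>\<close> by (intro nn_integral_indicator sets.Int)
  finally show ?thesis .
qed

definition closed_support :: "'a::topological_space measure \<Rightarrow> 'a set"
  where "closed_support M = {x. \<forall>U. open U \<and> x \<in> U \<longrightarrow> 0 < emeasure M U}"

end

theory Submission
  imports Defs
begin

text \<open>
  For half lines based at points \<open>a \<le> b\<close> on the same side of \<open>0\<close>, the signed tail indicators differ by
  the indicator of \<open>(a, b]\<close>. Multiplying over the coordinates and integrating, the \<open>\<Lambda>\<close>-measure of a box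
  \<open>(a, b]\<close> inside an open orthant is the increment of \<open>C\<close> over the box whose edges run from the tail
  integral of \<open>\<mu>\<^sub>i\<close> at \<open>b\<^sub>i\<close> to the one at \<open>a\<^sub>i\<close>. The intervals can be chosen arbitrarily close to \<open>0\<close>
  with \<open>\<mu>\<^sub>i (a\<^sub>i, b\<^sub>i] > 0\<close>, and then strict monotonicity of \<open>C\<close> makes the measure of the box positive.
  So the support of the small jumps meets every open orthant, hence every open half space bounded by a
  hyperplane through \<open>0\<close>.
\<close>

section \<open>Convex separation, closed supports and null sets\<close>

text \<open>Otherwise a hyperplane through 0 keeps the interior of the hull on one side. If that
  interior is nonempty, \<open>S\<close> lies in its closure and so on the same side, against the
  assumption.\<close>

lemma zero_in_interior_convex_hullI:
  fixes S :: "'a::euclidean_space set"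
  assumes S: "\<And>w. w \<noteq> 0 \<Longrightarrow> \<exists>x\<in>S. w \<bullet> x < 0"
  shows "0 \<in> interior (convex hull S)"
proof (rule ccontr)
  let ?K = "convex hull S"
  assume "0 \<notin> interior ?K"
  moreover have "interior ?K \<noteq> {}"
  proof
    assume "interior ?K = {}"
    then obtain w b where w: "w \<noteq> 0" "?K \<subseteq> {x. w \<bullet> x = b}"
      using empty_interior_subset_hyperplane[of ?K] convex_convex_hull by metis
    \<comment> \<open>With empty interior the hull lies in one hyperplane, so \<open>b\<close> would
      be both negative and positive.\<close>
    obtain x y where "x \<in> S" "w \<bullet> x < 0" "y \<in> S" "- w \<bullet> y < 0"
      using S[of w] S[of "- w"] w(1) by (metis neg_equal_0_iff_equal)
    moreover have "w \<bullet> x = b" if "x \<in> S" for x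
      using w(2) hull_inc[OF that, of convex] by auto
    ultimately show False by force
  qed
  ultimately obtain w where w: "w \<noteq> 0" "\<And>x. x \<in> interior ?K \<Longrightarrow> 0 \<le> w \<bullet> x"
    using separating_hyperplane_set_0[of "interior ?K"] convex_interior[OF convex_convex_hull]
    by metis
  have "closure (interior ?K) \<subseteq> {x. 0 \<le> w \<bullet> x}"
    using w(2) by (intro closure_minimal closed_halfspace_component_ge closed_halfspace_ge) auto
  moreover have "S \<subseteq> closure (interior ?K)"
    using convex_closure_interior[of ?K] \<open>interior ?K \<noteq> {}\<close> convex_convex_hull
      hull_subset[of S convex] closure_subset[of ?K] by (metis order_trans)
  ultimately show False
    using S[OF w(1)] by force
qed

text \<open>The complement of the support is the union of all open null sets; by Lindelof countably
  many of them suffice, so it is null.\<close>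

lemma closed_support_Int_nonempty:
  fixes M :: "'a::second_countable_topology measure"
  assumes M: "sets M = sets borel" and A: "A \<in> sets borel" "emeasure M A > 0"
  shows "A \<inter> closed_support M \<noteq> {}"
proof
  assume disj: "A \<inter> closed_support M = {}"
  let ?N = "{U. open U \<and> emeasure M U = 0}"
  obtain F where F: "F \<subseteq> ?N" "countable F" "\<Union>F = \<Union>?N"
    using Lindelof[of ?N] by auto
  have "\<Union>F \<in> null_sets M"
    using F(1,2) by (intro null_sets_UN'[of F "\<lambda>U. U", simplified]) (auto simp: null_sets_def M)
  moreover have "A \<subseteq> \<Union>F"
    unfolding F(3) using disj not_gr_zero unfolding closed_support_def by blast
  ultimately have "A \<in> null_sets M"
    using A(1) M null_sets_subset by blast
  with A(2) show False by auto
qed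

text \<open>Tail integrals measure half-open intervals. Those with rational endpoints inside
  \<open>{l<..<u}\<close> form a countable cover of it, so they cannot all be null.\<close>

lemma half_open_subinterval_pos:
  fixes M :: "real measure"
  assumes M: "sets M = sets borel" and pos: "emeasure M {l<..<u} > 0"
  obtains a b where "l < a" "a < b" "b < u" "emeasure M {a<..b} > 0"
proof -
  let ?P = "{(a, b). a \<in> \<rat> \<and> b \<in> \<rat> \<and> l < a \<and> b < u}"
  have "\<exists>(a, b) \<in> ?P. emeasure M {a<..b} > 0"
  proof (rule ccontr)
    assume neg: "\<not> ?thesis"
    have "countable ?P"
      by (rule countable_subset[of _ "\<rat> \<times> \<rat>"]) (auto simp: countable_rat)
    then have "(\<Union>p\<in>?P. {fst p<..snd p}) \<in> null_sets M"
      using neg by (intro null_sets_UN') (auto simp: null_sets_def M)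
    moreover have "{l<..<u} \<subseteq> (\<Union>p\<in>?P. {fst p<..snd p})"
    proof
      fix x assume x: "x \<in> {l<..<u}"
      then obtain a b where "a \<in> \<rat>" "l < a" "a < x" "b \<in> \<rat>" "x < b" "b < u"
        using Rats_dense_in_real[of l x] Rats_dense_in_real[of x u] by auto
      then have "(a, b) \<in> ?P" "x \<in> {fst (a, b)<..snd (a, b)}" by auto
      then show "x \<in> (\<Union>p\<in>?P. {fst p<..snd p})" by blast
    qed
    ultimately have "{l<..<u} \<in> null_sets M"
      using null_sets_subset[of _ M "{l<..<u}"] by (simp add: M)
    with pos show False by auto
  qed
  then obtain a b where ab: "l < a" "b < u" "emeasure M {a<..b} > 0" by auto
  \<comment> \<open>For \<open>b \<le> a\<close> the interval is empty and has no mass.\<close>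
  then have "a < b" by (intro not_le_imp_less notI) auto
  with ab that show thesis by blast
qed

section \<open>Levy measures and tail integrals away from the origin\<close>

text \<open>On \<open>A\<close> the integrable function \<open>min 1 ((norm x)\<^sup>2)\<close> is
  bounded below by a positive constant, so \<open>A\<close> has finite mass.\<close>

lemma levy_measure_integrable_indicator:
  assumes M: "levy_measure M" and A: "A \<in> sets borel" and r: "r > 0" "\<And>x. x \<in> A \<Longrightarrow> r \<le> norm x"
  shows "integrable M (indicator A :: _ \<Rightarrow> real)"
proof -
  let ?c = "min 1 (r\<^sup>2)"
  have c: "?c > 0" using r(1) by simp
  have sM: "sets M = sets borel" using M by (simp add: levy_measure_def)
  have "integrable M (\<lambda>x. ?c * indicator A x :: real)"
  proof (rule Bochner_Integration.integrable_bound)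
    show "integrable M (\<lambda>x. min 1 ((norm x)\<^sup>2))" using M by (simp add: levy_measure_def)
    show "(\<lambda>x. ?c * indicator A x :: real) \<in> borel_measurable M"
      using A sM by measurable
    have "?c \<le> min 1 ((norm x)\<^sup>2)" if "x \<in> A" for x
      using power_mono[OF r(2)[OF that], of 2] r(1) by (auto intro: min.coboundedI2)
    then show "AE x in M. norm (?c * indicator A x :: real) \<le> norm (min 1 ((norm x)\<^sup>2))"
      using c by (intro AE_I2) (auto simp: indicator_def)
  qed
  then show ?thesis using c by simp
qed

lemma half_line_borel [measurable]: "half_line x \<in> sets borel"
  by (simp add: half_line_def)

lemma abs_le_of_half_line: "t \<in> half_line x \<Longrightarrow> \<bar>x\<bar> \<le> \<bar>t\<bar>"
  by (auto simp: half_line_def split: if_splits)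

text \<open>Left of 0 the half lines grow with their base point and \<open>sign\<close> is -1, so
  one formula serves both sides.\<close>

lemma indicator_eq_diff_half_lines:
  fixes a b t :: real
  assumes "a \<le> b" "0 < a \<or> b < 0"
  shows "(indicator {a<..b} t :: real) =
    sign (ereal a) * indicator (half_line a) t - sign (ereal b) * indicator (half_line b) t"
  using assms by (auto simp: half_line_def sign_def indicator_def)

lemma tail_integral_real_less:
  assumes M: "levy_measure M" and ab: "a < b" "0 < a \<or> b < 0" and pos: "emeasure M {a<..b} > 0"
  shows "tail_integral_real M b < tail_integral_real M a"
proof -
  have sM: "sets M = sets borel" using M by (simp add: levy_measure_def)
  have sp: "space M = UNIV" using sets_eq_imp_space_eq[OF sM] by simp
  have int: "integrable M (indicator (half_line x) :: _ \<Rightarrow> real)" if "x \<noteq> 0" for x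
    using that by (intro levy_measure_integrable_indicator[OF M, of _ "\<bar>x\<bar>"])
      (auto dest: abs_le_of_half_line)
  have intab: "integrable M (indicator {a<..b} :: _ \<Rightarrow> real)"
    using ab by (intro levy_measure_integrable_indicator[OF M, of _ "min \<bar>a\<bar> \<bar>b\<bar>"]) auto
  have "measure M {a<..b} = (\<integral>x. indicator {a<..b} x \<partial>M)"
    by (simp add: sp)
  also have "\<dots> = (\<integral>x. sign (ereal a) * indicator (half_line a) x
      - sign (ereal b) * indicator (half_line b) x \<partial>M)"
    using ab by (simp add: indicator_eq_diff_half_lines)
  also have "\<dots> = tail_integral_real M a - tail_integral_real M b"
    using int[of a] int[of b] ab by (subst Bochner_Integration.integral_diff)
      (auto simp: tail_integral_real_def sp)
  finally have "tail_integral_real M a - tail_integral_real M b = measure M {a<..b}" ..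
  \<comment> \<open>Finiteness matters here: \<open>measure\<close> would turn infinite mass into
    0.\<close>
  moreover have "measure M {a<..b} > 0"
    using intab pos sM by (simp add: integrable_indicator_iff emeasure_eq_ennreal_measure
      less_top sp ennreal_less_iff)
  ultimately show ?thesis by simp
qed

section \<open>Boxes inside orthants and increments of the copula\<close>

text \<open>The complement of \<open>UNIV\<close> is empty, so the sum has a single term, constant
  in \<open>u\<close>.\<close>

lemma has_margin_UNIV: "has_margin C UNIV x l \<longleftrightarrow> C x = l"
  by (auto simp: has_margin_def tendsto_const_iff simp flip: one_ereal_def)

lemma tail_integral_UNIV:
  fixes \<Lambda> :: "(real^'d::finite) measure"
  assumes \<Lambda>: "levy_measure \<Lambda>" and v: "\<And>i. v i \<noteq> 0"
  shows "tail_integral UNIV (marginal_levy_measure UNIV \<Lambda>) v =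
    measure \<Lambda> {x. \<forall>j. x $ j \<in> half_line (v j)} * (\<Prod>i\<in>UNIV. sign (ereal (v i)))"
proof -
  have "emeasure (marginal_levy_measure UNIV \<Lambda>) (\<Pi>\<^sub>E j\<in>UNIV. half_line (v j)) =
    emeasure \<Lambda> {x. (\<lambda>i\<in>UNIV. x $ i) \<in> (\<Pi>\<^sub>E j\<in>UNIV. half_line (v j))}"
  proof (rule emeasure_marginal_levy_measure)
    show "sets \<Lambda> = sets borel" using \<Lambda> by (simp add: levy_measure_def)
    show "(\<Pi>\<^sub>E j\<in>UNIV. half_line (v j)) \<in> sets (\<Pi>\<^sub>M i\<in>UNIV. borel)"
      by (intro sets_PiM_I_finite) auto
    \<comment> \<open>Half lines with nonzero base point omit 0, so deleting the origin from the
      marginal measure changes nothing.\<close>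
    show "(\<lambda>i\<in>UNIV. 0) \<notin> (\<Pi>\<^sub>E j\<in>UNIV. half_line (v j))"
      using v by (auto simp: half_line_def PiE_iff not_less dest: spec split: if_splits)
  qed
  then show ?thesis
    by (simp add: tail_integral_def measure_def PiE_iff)
qed

lemma measure_box_eq_rect_increment:
  fixes \<Lambda> :: "(real^'d::finite) measure"
  assumes \<Lambda>: "levy_measure \<Lambda>" and C: "has_levy_copula \<Lambda> C \<mu>"
    and ab: "\<And>i. a i \<le> b i" "\<And>i. 0 < a i \<or> b i < 0"
  shows "ereal (measure \<Lambda> {x. \<forall>j. x $ j \<in> {a j<..b j}}) =
    rect_increment C (\<lambda>i. ereal (tail_integral_real (\<mu> i) (b i)))
      (\<lambda>i. ereal (tail_integral_real (\<mu> i) (a i)))"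
proof -
  \<comment> \<open>Tail integrals decrease, so the lower corner of the copula box (index 0) comes
    from \<open>b\<close>.\<close>
  define V where "V g j = (if g j = (0::nat) then b j else a j)" for g :: "'d \<Rightarrow> nat" and j
  define H where "H g = {x :: real^'d. \<forall>j. x $ j \<in> half_line (V g j)}" for g
  define G where "G = (UNIV :: 'd set) \<rightarrow>\<^sub>E {0, 1::nat}"
  define c where "c g = (-1::real) ^ (CARD('d) - (\<Sum>j\<in>UNIV. g j))" for g :: "'d \<Rightarrow> nat"
  define s where "s g = (\<Prod>j\<in>UNIV. sign (ereal (V g j)))" for g
  have sM: "sets \<Lambda> = sets borel" using \<Lambda> by (simp add: levy_measure_def)
  have sp: "space \<Lambda> = UNIV" using sets_eq_imp_space_eq[OF sM] by simp
  have V0: "V g j \<noteq> 0" for g j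
    using ab(1)[of j] ab(2)[of j] by (auto simp: V_def)
  have int: "integrable \<Lambda> (indicator (H g) :: _ \<Rightarrow> real)" for g
  proof -
    \<comment> \<open>Any one coordinate keeps \<open>H g\<close> away from the origin.\<close>
    fix j0 :: 'd
    show ?thesis
    proof (rule levy_measure_integrable_indicator[OF \<Lambda>])
      show "H g \<in> sets borel" unfolding H_def by measurable
      show "\<bar>V g j0\<bar> > 0" using V0 by simp
      show "\<bar>V g j0\<bar> \<le> norm x" if "x \<in> H g" for x
        using that abs_le_of_half_line[of "x $ j0" "V g j0"] component_le_norm_cart[of x j0]
        by (auto simp: H_def)
    qed
  qed
  have sgn: "(\<Prod>j\<in>UNIV. (-1::real) ^ (1 - g j)) = c g" if "g \<in> G" for g
  proof -
    \<comment> \<open>This bound keeps the subtraction on naturals from truncating.\<close>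
    have "g j \<le> 1" for j using that by (auto simp: G_def PiE_iff dest: spec[of _ j])
    then have "(\<Sum>j\<in>UNIV. 1 - g j) = CARD('d) - (\<Sum>j\<in>UNIV. g j)"
      by (subst sum_subtractf_nat) auto
    then show ?thesis by (simp add: c_def flip: power_sum)
  qed
  have box: "(indicator {x. \<forall>j. x $ j \<in> {a j<..b j}} x :: real) =
      (\<Sum>g\<in>G. c g * s g * indicator (H g) x)" for x :: "real^'d"
  proof -
    \<comment> \<open>The terms \<open>k = 1\<close> and \<open>k = 0\<close> are the half-line
      terms at \<open>a j\<close> and, negated, at \<open>b j\<close>; expanding the product of
      their sums yields the vertices of the box.\<close>
    define f where "f j k = (-1::real) ^ (1 - k) * (sign (ereal (if k = (0::nat) then b j else a j))
      * indicator (half_line (if k = 0 then b j else a j)) (x $ j))" for j k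
    have "(indicator {x. \<forall>j. x $ j \<in> {a j<..b j}} x :: real) =
        (\<Prod>j\<in>UNIV. indicator {a j<..b j} (x $ j))"
      by (auto simp: indicator_def prod_zero_iff)
    also have "\<dots> = (\<Prod>j\<in>UNIV. \<Sum>k\<in>{0, 1}. f j k)"
      using ab by (intro prod.cong) (auto simp: indicator_eq_diff_half_lines f_def)
    also have "\<dots> = (\<Sum>g\<in>G. \<Prod>j\<in>UNIV. f j (g j))"
      unfolding G_def by (rule prod_sum_PiE) auto
    also have "\<dots> = (\<Sum>g\<in>G. c g * s g * indicator (H g) x)"
    proof (rule sum.cong[OF refl])
      fix g assume g: "g \<in> G"
      have "(\<Prod>j\<in>UNIV. indicator (half_line (V g j)) (x $ j)) = (indicator (H g) x :: real)"
        by (auto simp: indicator_def H_def prod_zero_iff)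
      then show "(\<Prod>j\<in>UNIV. f j (g j)) = c g * s g * indicator (H g) x"
        by (simp add: f_def prod.distrib sgn[OF g, unfolded One_nat_def] s_def flip: V_def)
    qed
    finally show ?thesis .
  qed
  have CV: "C (\<lambda>i. ereal (tail_integral_real (\<mu> i) (V g i))) = ereal (s g * measure \<Lambda> (H g))" for g
    using C V0 unfolding has_levy_copula_def
    by (auto dest!: spec[of _ UNIV] spec[of _ "V g"]
        simp: has_margin_UNIV tail_integral_UNIV[OF \<Lambda>] s_def H_def mult.commute)
  have "measure \<Lambda> {x. \<forall>j. x $ j \<in> {a j<..b j}} =
      (\<integral>x. indicator {x. \<forall>j. x $ j \<in> {a j<..b j}} x \<partial>\<Lambda>)"
    by (simp add: sp)
  also have "\<dots> = (\<Sum>g\<in>G. c g * s g * measure \<Lambda> (H g))"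
    unfolding box using int by (subst Bochner_Integration.integral_sum) (auto simp: sp)
  finally have "ereal (measure \<Lambda> {x. \<forall>j. x $ j \<in> {a j<..b j}}) =
      (\<Sum>g\<in>G. ereal (c g * (s g * measure \<Lambda> (H g))))"
    by (simp add: mult.assoc)
  also have "\<dots> = (\<Sum>g\<in>G. ereal (c g) * C (\<lambda>i. ereal (tail_integral_real (\<mu> i) (V g i))))"
    by (simp add: CV)
  also have "\<dots> = rect_increment C (\<lambda>i. ereal (tail_integral_real (\<mu> i) (b i)))
      (\<lambda>i. ereal (tail_integral_real (\<mu> i) (a i)))"
    unfolding rect_increment_def G_def[symmetric]
  proof (intro sum.cong refl)
    fix g
    have "(\<lambda>i. ereal (tail_integral_real (\<mu> i) (V g i))) = (\<lambda>j. if g j = 0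
        then ereal (tail_integral_real (\<mu> j) (b j)) else ereal (tail_integral_real (\<mu> j) (a j)))"
      by (auto simp: V_def)
    moreover have "ereal (c g) = (-1) ^ (CARD('d) - (\<Sum>j\<in>UNIV. g j))"
      by (simp add: c_def one_ereal_def flip: ereal_power)
    ultimately show "ereal (c g) * C (\<lambda>i. ereal (tail_integral_real (\<mu> i) (V g i))) =
      (-1) ^ (CARD('d) - (\<Sum>j\<in>UNIV. g j)) * C (\<lambda>j. if g j = 0
        then ereal (tail_integral_real (\<mu> j) (b j)) else ereal (tail_integral_real (\<mu> j) (a j)))"
      by simp
  qed
  finally show ?thesis .
qed

lemma emeasure_box_pos:
  fixes \<Lambda> :: "(real^'d::finite) measure"
  assumes \<Lambda>: "levy_measure \<Lambda>" and \<mu>: "\<And>i. levy_measure (\<mu> i)"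
    and C: "has_levy_copula \<Lambda> C \<mu>" "strictly_d_increasing C"
    and ab: "\<And>i. a i < b i" "\<And>i. 0 < a i \<or> b i < 0" "\<And>i. emeasure (\<mu> i) {a i<..b i} > 0"
  shows "emeasure \<Lambda> {x. \<forall>j. x $ j \<in> {a j<..b j}} > 0"
proof -
  \<comment> \<open>Positive mass of each \<open>{a i<..b i}\<close> makes every edge of the copula
    box nondegenerate.\<close>
  have "0 < rect_increment C (\<lambda>i. ereal (tail_integral_real (\<mu> i) (b i)))
      (\<lambda>i. ereal (tail_integral_real (\<mu> i) (a i)))"
    using C(2) tail_integral_real_less[OF \<mu> ab]
    unfolding strictly_d_increasing_def Rbar_def by simp
  then have "0 < measure \<Lambda> {x. \<forall>j. x $ j \<in> {a j<..b j}}"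
    by (subst (asm) measure_box_eq_rect_increment[OF \<Lambda> C(1), symmetric])
      (use ab in \<open>auto simp: less_imp_le\<close>)
  then show ?thesis by (auto simp: measure_def zero_less_iff_neq_zero)
qed

section \<open>The support meets every open orthant\<close>

lemma closed_support_small_jumps_meets_orthant:
  fixes \<Lambda> :: "(real^'d::finite) measure" and P :: "'d set"
  assumes \<Lambda>: "levy_measure \<Lambda>" and \<mu>: "\<And>i. levy_measure (\<mu> i)"
    and C: "has_levy_copula \<Lambda> C \<mu>" "strictly_d_increasing C"
    and pos: "\<And>i \<epsilon>. \<epsilon> > 0 \<Longrightarrow> emeasure (\<mu> i) {-\<epsilon><..<0} > 0 \<and> emeasure (\<mu> i) {0<..<\<epsilon>} > 0"
    and \<epsilon>: "\<epsilon> > 0"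
  obtains x where "x \<in> closed_support (small_jumps \<Lambda> \<epsilon>)"
    "\<And>i. i \<in> P \<Longrightarrow> x $ i > 0" "\<And>i. i \<notin> P \<Longrightarrow> x $ i < 0"
proof -
  \<comment> \<open>Coordinates below \<open>\<delta>\<close> in modulus give an l1 norm below
    \<open>\<epsilon>\<close>, which bounds the Euclidean norm.\<close>
  define \<delta> where "\<delta> = \<epsilon> / CARD('d)"
  have \<delta>: "\<delta> > 0" using \<epsilon> by (simp add: \<delta>_def)
  have "\<exists>a b. a < b \<and> (if i \<in> P then 0 < a \<and> b < \<delta> else -\<delta> < a \<and> b < 0) \<and>
      emeasure (\<mu> i) {a<..b} > 0" for i
  proof -
    define l u where "l = (if i \<in> P then 0 else -\<delta>)" and "u = (if i \<in> P then \<delta> else 0)"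
    have "sets (\<mu> i) = sets borel" using \<mu> by (simp add: levy_measure_def)
    moreover have "emeasure (\<mu> i) {l<..<u} > 0" using pos[OF \<delta>] by (simp add: l_def u_def)
    ultimately obtain a b where "l < a" "a < b" "b < u" "emeasure (\<mu> i) {a<..b} > 0"
      by (rule half_open_subinterval_pos)
    then show ?thesis unfolding l_def u_def by (cases "i \<in> P") auto
  qed
  then obtain a b where ab: "a i < b i" "emeasure (\<mu> i) {a i<..b i} > 0"
      "if i \<in> P then 0 < a i \<and> b i < \<delta> else -\<delta> < a i \<and> b i < 0" for i
    by metis
  let ?B = "{x :: real^'d. \<forall>j. x $ j \<in> {a j<..b j}}"
  have sM: "sets \<Lambda> = sets borel" using \<Lambda> by (simp add: levy_measure_def)
  have B: "?B \<in> sets borel" by measurable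
  have "?B \<subseteq> ball 0 \<epsilon>"
  proof
    fix x :: "real^'d" assume x: "x \<in> ?B"
    have "\<bar>x $ i\<bar> < \<delta>" for i
      using x ab(3)[of i] by (auto dest!: spec[of _ i] split: if_splits)
    then have "(\<Sum>i\<in>UNIV. \<bar>x $ i\<bar>) < (\<Sum>i\<in>(UNIV :: 'd set). \<delta>)"
      by (intro sum_strict_mono) auto
    then show "x \<in> ball 0 \<epsilon>"
      using norm_le_l1_cart[of x] by (simp add: \<delta>_def)
  qed
  moreover have "0 < a i \<or> b i < 0" for i
    using ab(3)[of i] by (auto split: if_splits)
  then have "emeasure \<Lambda> ?B > 0"
    using emeasure_box_pos[OF \<Lambda> \<mu> C, of a b] ab(1,2) by auto
  ultimately have "emeasure (small_jumps \<Lambda> \<epsilon>) ?B > 0"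
    using emeasure_small_jumps[OF sM B, of \<epsilon>] by (simp add: Int_absorb2)
  then obtain x where x: "x \<in> ?B" "x \<in> closed_support (small_jumps \<Lambda> \<epsilon>)"
    using closed_support_Int_nonempty[OF _ B, of "small_jumps \<Lambda> \<epsilon>"] sM
    by (auto simp: small_jumps_def)
  show thesis
  proof (rule that[OF x(2)])
    show "x $ i > 0" if "i \<in> P" for i
      using x(1) ab(3)[of i] that by (auto dest!: spec[of _ i])
    show "x $ i < 0" if "i \<notin> P" for i
      using x(1) ab(3)[of i] that by (auto dest!: spec[of _ i])
  qed
qed

theorem proposition3p21:
  fixes \<Lambda> :: "(real^'d::finite) measure"
    and C :: "('d \<Rightarrow> ereal) \<Rightarrow> ereal"
    and \<mu> :: "'d \<Rightarrow> real measure"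
  assumes "CARD('d) \<ge> 2"
    and "levy_measure \<Lambda>"
    and "levy_copula C"
    and "\<And>i. levy_measure (\<mu> i)"
    and "has_levy_copula \<Lambda> C \<mu>"
    and "strictly_d_increasing C"
    and "\<And>i \<epsilon>. \<epsilon> > 0 \<Longrightarrow> emeasure (\<mu> i) {-\<epsilon><..<0} > 0 \<and> emeasure (\<mu> i) {0<..<\<epsilon>} > 0"
  shows "\<forall>\<epsilon>>0. 0 \<in> interior (convex hull (closed_support (small_jumps \<Lambda> \<epsilon>)))"
proof (intro allI impI zero_in_interior_convex_hullI)
  fix \<epsilon> :: real and w :: "real^'d"
  assume "\<epsilon> > 0" "w \<noteq> 0"
  then obtain k where k: "w $ k \<noteq> 0" by (auto simp: vec_eq_iff)
  \<comment> \<open>The orthant is chosen opposite to \<open>w\<close>, so no term of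
    \<open>w \<bullet> x\<close> is positive; the coordinate \<open>k\<close> makes the sum strictly
    negative.\<close>
  obtain x where x: "x \<in> closed_support (small_jumps \<Lambda> \<epsilon>)"
      "\<And>i. w $ i < 0 \<Longrightarrow> x $ i > 0" "\<And>i. \<not> w $ i < 0 \<Longrightarrow> x $ i < 0"
    using closed_support_small_jumps_meets_orthant[OF assms(2,4,5,6,7) \<open>\<epsilon> > 0\<close>,
        of "{i. w $ i < 0}"] by auto
  have "w $ i * x $ i \<le> 0" for i
    using x(2,3)[of i] by (cases "w $ i < 0") (auto simp: mult_le_0_iff)
  moreover have "w $ k * x $ k < 0"
    using x(2,3)[of k] k by (cases "w $ k < 0") (auto simp: mult_less_0_iff)
  ultimately have "w \<bullet> x < 0"
    using sum_strict_mono_ex1[of UNIV "\<lambda>i. w $ i * x $ i" "\<lambda>_. 0"]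
    by (auto simp: inner_vec_def)
  with x(1) show "\<exists>x\<in>closed_support (small_jumps \<Lambda> \<epsilon>). w \<bullet> x < 0" by blast
qed

end
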